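(* Let $k\ge 2$ be an integer. There exists $\lambda_0>0$ (depending on $k$) such that for every real $\lambda$ with $0<\lambda<\lambda_0$, the finite sequence $p_{k+1},p_{k+2},\dots,p_{2k}$ is strictly decreasing, i.e. $p_n-p_{n-1}<0$ for all integers $n$ with $k+2\le n\le 2k$, and concave, i.e. $p_n-2p_{n-1}+p_{n-2}<0$ for all integers $n$ with $k+3\le n\le 2k$.
   Context: For an integer $k\ge 1$ and real $\lambda>0$, the Poisson distribution of order $k$ with parameter $\lambda$ has probability mass function $f_k(n;\lambda)=e^{-k\lambda}\sum \frac{\lambda^{n_1+\cdots+n_k}}{n_1!\cdots n_k!}$ for $n=0,1,2,\dots$, where the sum is over all tuples of nonnegative integers $(n_1,\dots,n_k)$ with $n_1+2n_2+\cdots+kn_k=n$. The scaled pmf is $p_n=h_k(n;\lambda)=e^{k\lambda}f_k(n;\lambda)=\sum_{n_1+2n_2+\cdots+kn_k=n}\frac{\lambda^{n_1+\cdots+n_k}}{n_1!\cdots n_k!}$ (the dependence on $k$ and $\lambda$ is suppressed in the notation $p_n$). Conditions on an empty range of $n$ are vacuous. *)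

theory Defs
  imports Complex_Main "HOL-Library.FuncSet"
begin

text \<open>A tuple \<open>(n\<^sub>1, \<dots>, n\<^sub>k)\<close> is an extensional function on \<open>{1..k}\<close>, so that
  distinct functions are distinct tuples and the index set below is finite.\<close>

definition order_tuples :: "nat \<Rightarrow> nat \<Rightarrow> (nat \<Rightarrow> nat) set" where
  "order_tuples k n = {m \<in> {1..k} \<rightarrow>\<^sub>E UNIV. (\<Sum>i = 1..k. i * m i) = n}"

definition poisson_order_pmf :: "nat \<Rightarrow> real \<Rightarrow> nat \<Rightarrow> real" where
  "poisson_order_pmf k l n =
     exp (- (real k * l)) *
     (\<Sum>m \<in> order_tuples k n. l ^ (\<Sum>i = 1..k. m i) / (\<Prod>i = 1..k. fact (m i)))"

definition scaled_pmf :: "nat \<Rightarrow> real \<Rightarrow> nat \<Rightarrow> real" where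
  "scaled_pmf k l n = exp (real k * l) * poisson_order_pmf k l n"

lemma finite_order_tuples: "finite (order_tuples k n)"
proof (rule finite_subset)
  show "order_tuples k n \<subseteq> {1..k} \<rightarrow>\<^sub>E {..n}"
  proof
    fix m assume m: "m \<in> order_tuples k n"
    have "m i \<le> n" if i: "i \<in> {1..k}" for i
    proof -
      have "m i \<le> i * m i" using i by simp
      also have "\<dots> \<le> (\<Sum>i = 1..k. i * m i)"
        by (rule member_le_sum) (use i in auto)
      also have "\<dots> = n" using m by (simp add: order_tuples_def)
      finally show ?thesis .
    qed
    then show "m \<in> {1..k} \<rightarrow>\<^sub>E {..n}"
      using m unfolding order_tuples_def by (simp add: PiE_iff)
  qed
qed (simp add: finite_PiE)

lemma scaled_pmf_eq:
  "scaled_pmf k l n =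
     (\<Sum>m \<in> order_tuples k n. l ^ (\<Sum>i = 1..k. m i) / (\<Prod>i = 1..k. fact (m i)))"
  unfolding scaled_pmf_def poisson_order_pmf_def mult.assoc[symmetric]
  by (simp flip: exp_add)

end

theory Submission
  imports Defs
begin

text \<open>Grade the tuples by \<open>n\<^sub>1 + \<dots> + n\<^sub>k = j\<close>, so that \<open>p\<^sub>n = (\<Sum>j. c\<^sub>j(n) \<lambda>\<^sup>j)\<close>, where \<open>j! c\<^sub>j(n)\<close>
  counts the compositions of \<open>n\<close> into \<open>j\<close> parts from \<open>{1..k}\<close>. Splitting off one part gives
  \<open>(j + 1) c\<^sub>j\<^sub>+\<^sub>1(n) = (\<Sum>i = 1..k. c\<^sub>j(n - i))\<close>. For \<open>k < n \<le> 2k\<close> the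
  coefficients \<open>c\<^sub>0(n)\<close> and \<open>c\<^sub>1(n)\<close> vanish and \<open>c\<^sub>2(n) = (2k + 1 - n)/2\<close>; hence the first difference
  of \<open>p\<close> is \<open>- \<lambda>\<^sup>2/2 + O(\<lambda>\<^sup>3)\<close>. Since \<open>c\<^sub>2\<close> is affine there, the second difference is governed
  by \<open>c\<^sub>3\<close>, and the recurrence shows that it is \<open>- \<lambda>\<^sup>3/3 + O(\<lambda>\<^sup>4)\<close>.\<close>

definition sized_tuples :: "nat \<Rightarrow> nat \<Rightarrow> nat \<Rightarrow> (nat \<Rightarrow> nat) set" where
  "sized_tuples k j n = {m \<in> order_tuples k n. (\<Sum>i = 1..k. m i) = j}"

definition size_coeff :: "nat \<Rightarrow> nat \<Rightarrow> nat \<Rightarrow> real" where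
  "size_coeff k j n = (\<Sum>m \<in> sized_tuples k j n. 1 / (\<Prod>i = 1..k. fact (m i)))"

lemma finite_sized_tuples: "finite (sized_tuples k j n)"
  unfolding sized_tuples_def using finite_order_tuples by simp

lemma order_tuples_size_le:
  assumes "m \<in> order_tuples k n"
  shows "(\<Sum>i = 1..k. m i) \<le> n"
proof -
  have "(\<Sum>i = 1..k. m i) \<le> (\<Sum>i = 1..k. i * m i)" by (rule sum_mono) simp
  then show ?thesis using assms by (simp add: order_tuples_def)
qed

text \<open>A tuple with total \<open>n\<close> has size at most \<open>n\<close>, so any
  \<open>N\<close> above \<open>n\<close> is a valid degree bound. The freedom in \<open>N\<close>
  lets neighbouring terms share one range and be subtracted coefficientwise.\<close>

lemma scaled_pmf_eq_poly:
  assumes "n \<le> N"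
  shows "scaled_pmf k l n = (\<Sum>j\<le>N. size_coeff k j n * l ^ j)"
proof -
  have "(\<Sum>j\<le>N. \<Sum>m\<in>{m \<in> order_tuples k n. (\<Sum>i = 1..k. m i) = j}.
            l ^ (\<Sum>i = 1..k. m i) / (\<Prod>i = 1..k. fact (m i)))
        = scaled_pmf k l n"
    unfolding scaled_pmf_eq
  proof (rule sum.group)
    show "(\<lambda>m. \<Sum>i = 1..k. m i) ` order_tuples k n \<subseteq> {..N}"
      using order_tuples_size_le[of _ k n] assms by (meson atMost_iff image_subsetI order_trans)
  qed (simp_all add: finite_order_tuples)
  then show ?thesis
    by (simp add: size_coeff_def sized_tuples_def sum_distrib_right)
qed

text \<open>The weight \<open>w\<close> is constantly 1 for the size of a tuple and the identity for
  its total.\<close>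

lemma sum_upd_Suc:
  fixes m w :: "nat \<Rightarrow> nat"
  assumes "finite A" "i \<in> A"
  shows "(\<Sum>a\<in>A. w a * (m(i := Suc (m i))) a) = (\<Sum>a\<in>A. w a * m a) + w i"
  using assms by (simp add: sum.remove)

lemma prod_fact_upd_Suc:
  fixes m :: "nat \<Rightarrow> nat"
  assumes "finite A" "i \<in> A"
  shows "(\<Prod>a\<in>A. fact ((m(i := Suc (m i))) a) :: real) = real (Suc (m i)) * (\<Prod>a\<in>A. fact (m a))"
  using assms by (simp add: prod.remove)

text \<open>Removing one part \<open>i\<close> maps the tuples with \<open>m i \<noteq> 0\<close>
  bijectively to those of size \<open>j\<close> and total \<open>n - i\<close>, and the factor
  \<open>m i\<close> turns \<open>fact (m i)\<close> into \<open>fact (m i - 1)\<close>. For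
  \<open>i > n\<close> no such tuple exists, whereas the truncated \<open>n - i\<close> would be 0;
  hence the case split.\<close>

lemma sum_sized_tuples_part:
  assumes i: "i \<in> {1..k}"
  shows "(\<Sum>m \<in> sized_tuples k (Suc j) n. real (m i) / (\<Prod>a = 1..k. fact (m a)))
       = (if i \<le> n then size_coeff k j (n - i) else 0)"
proof -
  let ?S = "{m \<in> sized_tuples k (Suc j) n. m i \<noteq> 0}"
  let ?up = "\<lambda>m. m(i := Suc (m i))"
  \<comment> \<open>Tuples with \<open>m i = 0\<close> contribute nothing, and on them the truncated
    decrement could not be undone.\<close>
  have restrict: "(\<Sum>m \<in> sized_tuples k (Suc j) n. real (m i) / (\<Prod>a = 1..k. fact (m a)))
      = (\<Sum>m \<in> ?S. real (m i) / (\<Prod>a = 1..k. fact (m a)))"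
    by (rule sum.mono_neutral_right) (auto simp: finite_sized_tuples)
  have up_mem: "?up m \<in> sized_tuples k (Suc j) n \<longleftrightarrow> i \<le> n \<and> m \<in> sized_tuples k j (n - i)"
    if "m \<in> {1..k} \<rightarrow>\<^sub>E UNIV" for m
  proof -
    have "?up m \<in> {1..k} \<rightarrow>\<^sub>E UNIV" using that i by (auto simp: PiE_iff extensional_def)
    moreover have "(\<Sum>a = 1..k. ?up m a) = Suc (\<Sum>a = 1..k. m a)"
      using sum_upd_Suc[of "{1..k}" i "\<lambda>_. 1" m] i by simp
    moreover have "(\<Sum>a = 1..k. a * ?up m a) = (\<Sum>a = 1..k. a * m a) + i"
      using sum_upd_Suc[of "{1..k}" i "\<lambda>a. a" m] i by simp
    ultimately show ?thesis
      using that by (simp only: sized_tuples_def order_tuples_def mem_Collect_eq) auto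
  qed
  have down: "m(i := m i - 1) \<in> {1..k} \<rightarrow>\<^sub>E UNIV" if "m \<in> ?S" for m
    using that i by (auto simp: sized_tuples_def order_tuples_def PiE_iff extensional_def)
  have up_down: "?up (m(i := m i - 1)) = m" if "m \<in> ?S" for m
    using that by auto
  show ?thesis
  proof (cases "i \<le> n")
    case True
    have "(\<Sum>m \<in> ?S. real (m i) / (\<Prod>a = 1..k. fact (m a))) = size_coeff k j (n - i)"
      unfolding size_coeff_def
    proof (rule sum.reindex_bij_witness[where i = ?up and j = "\<lambda>m. m(i := m i - 1)"])
      fix m assume m: "m \<in> ?S"
      show "?up (m(i := m i - 1)) = m" by (rule up_down[OF m])
      show "m(i := m i - 1) \<in> sized_tuples k j (n - i)"
        using up_mem[OF down[OF m]] up_down[OF m] m by auto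
      have "(\<Prod>a = 1..k. fact (m a)) = real (m i) * (\<Prod>a = 1..k. fact ((m(i := m i - 1)) a))"
        using prod_fact_upd_Suc[of "{1..k}" i "m(i := m i - 1)"] i up_down[OF m] m
        by (simp del: fun_upd_apply add: fun_upd_same)
      then show "1 / (\<Prod>a = 1..k. fact ((m(i := m i - 1)) a))
               = real (m i) / (\<Prod>a = 1..k. fact (m a))"
        using m by (simp del: fun_upd_apply)
    next
      fix m assume m: "m \<in> sized_tuples k j (n - i)"
      show "(?up m)(i := ?up m i - 1) = m" by auto
      have "m \<in> {1..k} \<rightarrow>\<^sub>E UNIV" using m by (simp add: sized_tuples_def order_tuples_def)
      then show "?up m \<in> ?S" using up_mem m True by simp
    qed
    then show ?thesis using restrict True by simp
  next
    case False
    have "?S = {}"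
    proof (rule ccontr)
      assume "?S \<noteq> {}"
      then obtain m where m: "m \<in> ?S" by blast
      show False using up_mem[OF down[OF m]] up_down[OF m] m False by auto
    qed
    then show ?thesis using restrict False by (simp only: sum.empty if_False)
  qed
qed

text \<open>The factor \<open>Suc j\<close> is the size of every tuple in the sum; writing it as the
  sum of the \<open>m i\<close> and swapping the sums isolates one part at a time.\<close>

lemma size_coeff_Suc:
  "real (Suc j) * size_coeff k (Suc j) n =
     (\<Sum>i = 1..k. if i \<le> n then size_coeff k j (n - i) else 0)"
proof -
  have "real (Suc j) * size_coeff k (Suc j) n =
      (\<Sum>m \<in> sized_tuples k (Suc j) n. (\<Sum>i = 1..k. real (m i)) / (\<Prod>a = 1..k. fact (m a)))"
    unfolding size_coeff_def sum_distrib_left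
    by (rule sum.cong) (auto simp: sized_tuples_def simp flip: of_nat_sum)
  also have "\<dots> = (\<Sum>i = 1..k. \<Sum>m \<in> sized_tuples k (Suc j) n.
      real (m i) / (\<Prod>a = 1..k. fact (m a)))"
    unfolding sum_divide_distrib by (rule sum.swap)
  also have "\<dots> = (\<Sum>i = 1..k. if i \<le> n then size_coeff k j (n - i) else 0)"
    by (rule sum.cong[OF refl]) (rule sum_sized_tuples_part)
  finally show ?thesis .
qed

lemma size_coeff_0: "size_coeff k 0 n = (if n = 0 then 1 else 0)"
proof -
  have "m \<in> sized_tuples k 0 n \<longleftrightarrow> n = 0 \<and> m = (\<lambda>i\<in>{1..k}. 0)" for m
  proof
    assume m: "m \<in> sized_tuples k 0 n"
    then have zero: "\<forall>i\<in>{1..k}. m i = 0" by (simp add: sized_tuples_def)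
    moreover have "m \<in> extensional {1..k}" "(\<Sum>i = 1..k. i * m i) = n"
      using m by (auto simp only: sized_tuples_def order_tuples_def PiE_def)
    moreover from zero have "(\<Sum>i = 1..k. i * m i) = 0" by (intro sum.neutral) auto
    ultimately have "n = 0" "m \<in> extensional {1..k}" by argo+
    with zero show "n = 0 \<and> m = (\<lambda>i\<in>{1..k}. 0)"
      by (auto simp: extensional_def restrict_def fun_eq_iff)
  qed (simp add: sized_tuples_def order_tuples_def)
  then have "sized_tuples k 0 n = (if n = 0 then {\<lambda>i\<in>{1..k}. 0} else {})" by auto
  then show ?thesis by (simp add: size_coeff_def)
qed

lemma size_coeff_1: "size_coeff k 1 n = (if 1 \<le> n \<and> n \<le> k then 1 else 0)"
proof -
  have "size_coeff k 1 n = (\<Sum>i = 1..k. if i = n then 1 else 0)"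
    unfolding size_coeff_Suc[of 0 k n, simplified, folded One_nat_def]
    by (rule sum.cong) (auto simp: size_coeff_0)
  then show ?thesis by simp
qed

text \<open>The recurrences at \<open>n\<close> and \<open>n - 1\<close> sum over windows shifted by
  one, so only the two end terms survive. Since \<open>n - 1 > k\<close>, all guards
  \<open>i \<le> n\<close> and \<open>i \<le> n - 1\<close> hold.\<close>

lemma size_coeff_Suc_diff:
  assumes "k + 2 \<le> n"
  shows "real (Suc j) * (size_coeff k (Suc j) n - size_coeff k (Suc j) (n - 1)) =
    size_coeff k j (n - 1) - size_coeff k j (n - 1 - k)"
proof -
  \<comment> \<open>The window length is generalized apart from the \<open>k\<close> inside
    \<open>size_coeff\<close>, so that the induction varies only the length.\<close>
  have telescope: "(\<Sum>i = 1..k. f (n - i) - f (n - Suc i)) = f (n - 1) - f (n - 1 - k)"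
    for f :: "nat \<Rightarrow> real" and k
    by (induction k) auto
  have "real (Suc j) * (size_coeff k (Suc j) n - size_coeff k (Suc j) (n - 1))
      = (\<Sum>i = 1..k. size_coeff k j (n - i) - size_coeff k j (n - Suc i))"
    unfolding right_diff_distrib size_coeff_Suc sum_subtractf[symmetric]
    by (rule sum.cong) (use assms in auto)
  also have "\<dots> = size_coeff k j (n - 1) - size_coeff k j (n - 1 - k)"
    using telescope[of "size_coeff k j"] .
  finally show ?thesis .
qed

text \<open>The first part may be any of \<open>1, ..., n - 1\<close>; the second is then
  automatically at most \<open>k\<close>.\<close>

lemma size_coeff_2_small:
  assumes "1 \<le> n" "n \<le> k"
  shows "size_coeff k 2 n = (real n - 1) / 2"
proof -
  have "2 * size_coeff k 2 n = (\<Sum>i = 1..k. if i < n then 1 else 0)"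
    using size_coeff_Suc[of 1 k n] assms unfolding size_coeff_1
    by (simp add: numeral_2_eq_2) (rule sum.cong, auto)
  also have "\<dots> = (\<Sum>i = 1..<n. 1)"
    by (rule sum.mono_neutral_cong_right) (use assms in auto)
  also have "\<dots> = real n - 1" using assms by simp
  finally show ?thesis by simp
qed

text \<open>Of the two end terms, \<open>n - 1\<close> exceeds \<open>k\<close> and gives 0, while
  \<open>n - 1 - k\<close> lies in \<open>{1..k}\<close> and gives 1.\<close>

lemma size_coeff_2_diff:
  assumes "k + 2 \<le> n" "n \<le> 2 * k"
  shows "size_coeff k 2 n - size_coeff k 2 (n - 1) = - 1 / 2"
proof -
  have "2 * (size_coeff k 2 n - size_coeff k 2 (n - 1))
      = size_coeff k 1 (n - 1) - size_coeff k 1 (n - 1 - k)"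
    using size_coeff_Suc_diff[of k n 1] assms by (simp add: numeral_2_eq_2)
  also have "\<dots> = - 1" unfolding size_coeff_1 using assms by auto
  finally show ?thesis by simp
qed

text \<open>Three times the second difference is the step of \<open>size_coeff k 2\<close> from
  \<open>n - 2\<close> to \<open>n - 1\<close>, which is -1/2 on the falling side, minus its step
  \<open>k\<close> places earlier, which is 1/2 on the rising side.\<close>

lemma size_coeff_3_diff2:
  assumes "k + 3 \<le> n" "n \<le> 2 * k"
  shows "size_coeff k 3 n - 2 * size_coeff k 3 (n - 1) + size_coeff k 3 (n - 2) = - 1 / 3"
proof -
  have "3 * (size_coeff k 3 n - size_coeff k 3 (n - 1))
      = size_coeff k 2 (n - 1) - size_coeff k 2 (n - 1 - k)"
    using size_coeff_Suc_diff[of k n 2] assms by simp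
  moreover have "3 * (size_coeff k 3 (n - 1) - size_coeff k 3 (n - 2))
      = size_coeff k 2 (n - 2) - size_coeff k 2 (n - 2 - k)"
    using size_coeff_Suc_diff[of k "n - 1" 2] assms
    by (simp add: numeral_2_eq_2 numeral_3_eq_3)
  moreover have "size_coeff k 2 (n - 1) - size_coeff k 2 (n - 2) = - 1 / 2"
    using size_coeff_2_diff[of k "n - 1"] assms by (simp add: numeral_2_eq_2)
  moreover have "size_coeff k 2 (n - 1 - k) - size_coeff k 2 (n - 2 - k) = 1 / 2"
  proof -
    have "1 \<le> n - 1 - k" "n - 1 - k \<le> k" "1 \<le> n - 2 - k" "n - 2 - k \<le> k"
      and "real (n - 1 - k) = real (n - 2 - k) + 1"
      using assms by auto
    then show ?thesis by (simp only: size_coeff_2_small) argo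
  qed
  ultimately show ?thesis by argo
qed

text \<open>Dividing by \<open>x ^ d > 0\<close> leaves a polynomial that tends to
  \<open>a d < 0\<close> at 0.\<close>

lemma eventually_poly_neg:
  fixes a :: "nat \<Rightarrow> real"
  assumes "\<And>j. j < d \<Longrightarrow> a j = 0" "a d < 0" "d \<le> N"
  shows "eventually (\<lambda>x. (\<Sum>j\<le>N. a j * x ^ j) < 0) (at_right 0)"
proof -
  let ?q = "\<lambda>x. \<Sum>j = d..N. a j * x ^ (j - d)"
  have "(?q \<longlongrightarrow> ?q 0) (at_right 0)" by (intro tendsto_intros)
  \<comment> \<open>As \<open>0 ^ 0 = 1\<close>, exactly the term \<open>j = d\<close>
    remains.\<close>
  also have "?q 0 = (\<Sum>j = d..N. if j = d then a j else 0)"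
    by (rule sum.cong) (auto simp: power_0_left)
  also have "\<dots> = a d" using assms by simp
  finally have "eventually (\<lambda>x. ?q x < 0) (at_right 0)"
    using assms(2) by (rule order_tendstoD)
  with eventually_at_right_less[of 0] show ?thesis
  proof eventually_elim
    case (elim x)
    have "(\<Sum>j\<le>N. a j * x ^ j) = (\<Sum>j = d..N. a j * x ^ j)"
      by (rule sum.mono_neutral_right) (use assms(1) in auto)
    also have "\<dots> = x ^ d * ?q x"
      unfolding sum_distrib_left by (rule sum.cong) (auto simp flip: power_add)
    also have "\<dots> < 0" using elim by (simp add: mult_pos_neg)
    finally show ?case .
  qed
qed

theorem mainTheorem2:
  fixes k :: nat
  assumes "k \<ge> 2"
  shows "\<exists>l0 :: real. l0 > 0 \<and>
    (\<forall>l :: real. 0 < l \<and> l < l0 \<longrightarrow>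
      (\<forall>n :: nat. k + 2 \<le> n \<and> n \<le> 2 * k \<longrightarrow>
         scaled_pmf k l n - scaled_pmf k l (n - 1) < 0) \<and>
      (\<forall>n :: nat. k + 3 \<le> n \<and> n \<le> 2 * k \<longrightarrow>
         scaled_pmf k l n - 2 * scaled_pmf k l (n - 1) + scaled_pmf k l (n - 2) < 0))"
proof -
  \<comment> \<open>This covers every index in both differences: \<open>n - 1\<close> and
    \<open>n - 2\<close> respectively still exceed \<open>k\<close>.\<close>
  have low: "size_coeff k j n = 0" if "j < 2" "k < n" for j n
    using that size_coeff_0[of k n] size_coeff_1[of k n] by (auto simp: less_2_cases_iff)
  have decreasing: "eventually (\<lambda>l. scaled_pmf k l n - scaled_pmf k l (n - 1) < 0) (at_right 0)"
    if n: "n \<in> {k + 2..2 * k}" for n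
  proof -
    have "eventually (\<lambda>l. (\<Sum>j\<le>2 * k. (size_coeff k j n - size_coeff k j (n - 1)) * l ^ j) < 0)
        (at_right 0)"
      by (rule eventually_poly_neg[where d = 2]) (use n assms low size_coeff_2_diff[of k n] in auto)
    moreover have "n \<le> 2 * k" "n - 1 \<le> 2 * k" using n by auto
    ultimately show ?thesis
      by (simp only: scaled_pmf_eq_poly[where N = "2 * k"] sum_subtractf left_diff_distrib)
  qed
  have concave: "eventually (\<lambda>l. scaled_pmf k l n - 2 * scaled_pmf k l (n - 1)
      + scaled_pmf k l (n - 2) < 0) (at_right 0)"
    if n: "n \<in> {k + 3..2 * k}" for n
  proof -
    let ?c = "\<lambda>j. size_coeff k j n - 2 * size_coeff k j (n - 1) + size_coeff k j (n - 2)"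
    \<comment> \<open>Both consecutive first differences equal -1/2, so the sign is decided in
      degree 3.\<close>
    have "?c 2 = 0"
    proof -
      have "k + 2 \<le> n" "k + 2 \<le> n - 1" "n - 1 \<le> 2 * k" "n - 1 - 1 = n - 2"
        using n by auto
      then show ?thesis
        using size_coeff_2_diff[of k n] size_coeff_2_diff[of k "n - 1"] n by simp
    qed
    then have "?c j = 0" if "j < 3" for j
      using that low[of j n] low[of j "n - 1"] low[of j "n - 2"] n by (cases "j = 2") auto
    then have "eventually (\<lambda>l. (\<Sum>j\<le>2 * k. ?c j * l ^ j) < 0) (at_right 0)"
      by (rule eventually_poly_neg[where d = 3]) (use n assms size_coeff_3_diff2[of k n] in auto)
    moreover have "n \<le> 2 * k" "n - 1 \<le> 2 * k" "n - 2 \<le> 2 * k" using n by auto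
    ultimately show ?thesis
      by (simp only: scaled_pmf_eq_poly[where N = "2 * k"] sum_subtractf sum.distrib
          sum_distrib_left left_diff_distrib distrib_right mult.assoc)
  qed
  \<comment> \<open>Only finitely many \<open>n\<close> occur, so one threshold serves them
    all.\<close>
  have "eventually (\<lambda>l. \<forall>n\<in>{k + 2..2 * k}. scaled_pmf k l n - scaled_pmf k l (n - 1) < 0)
      (at_right 0)"
    by (rule eventually_ball_finite) (use decreasing in auto)
  moreover have "eventually (\<lambda>l. \<forall>n\<in>{k + 3..2 * k}. scaled_pmf k l n
      - 2 * scaled_pmf k l (n - 1) + scaled_pmf k l (n - 2) < 0) (at_right 0)"
    by (rule eventually_ball_finite) (use concave in auto)
  ultimately have "eventually (\<lambda>l.
      (\<forall>n\<in>{k + 2..2 * k}. scaled_pmf k l n - scaled_pmf k l (n - 1) < 0) \<and>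
      (\<forall>n\<in>{k + 3..2 * k}. scaled_pmf k l n
        - 2 * scaled_pmf k l (n - 1) + scaled_pmf k l (n - 2) < 0)) (at_right 0)"
    by (rule eventually_conj)
  then show ?thesis
    unfolding eventually_at_right_field by auto
qed

end
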